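(* Let $\phi$ be a minimal flow on a compact space $\mathcal{M}$, and suppose $\phi$ is an almost 1:1-extension of an almost periodic flow $\psi$ on $\Sigma$. Then the exponent groups coincide: $\mathcal{E}(\mathcal{M})=\mathcal{E}(\Sigma)$.
   Context: **Flows.** A flow on a space $X$ is a continuous group action of $(\mathbf{R},+)$ on $X$. A non-empty set $\mathcal{M}\subset X$ is a minimal set of a flow on $X$ if it is closed and invariant and has no proper non-empty subset that is also closed and invariant; a flow on $X$ is minimal if $X$ itself is a minimal set. **Exponent group.** Let $\pi^1:\mathbf{R}\to S^1=\mathbf{R}/\mathbf{Z}$ be the quotient map. The exponent group of an orbit $\phi_x:\mathbf{R}\to X$, $\phi_x(t)=\phi(t,x)$, of a flow $\phi$ on $X$ is the subgroup of $(\mathbf{R},+)$ $$\Big\{\alpha\in\mathbf{R}\;\Big|\;\{\pi^1(\alpha t_i)\}\text{ converges in }S^1\text{ for all sequences }\{t_i\}\subset\mathbf{R}\text{ for which }\{\phi_x(t_i)\}\text{ converges in }X\Big\}.$$ It is known that the exponent group is the same for all orbits of a minimal set $\mathcal{M}$ of a flow; this common group is denoted $\mathcal{E}(\mathcal{M})$. Here $\mathcal{E}(\mathcal{M})$ is taken with respect to $\phi$ and $\mathcal{E}(\Sigma)$ with respect to $\psi$ (the flow $\psi$ is minimal, being a factor of the minimal flow $\phi$). **Almost 1:1-extension.** A semiconjugacy between a flow $\phi$ on $X$ and a flow $\psi$ on $Y$ is a continuous surjection $h:X\to Y$ with $h(\phi(t,x))=\psi(t,h(x))$ for all $t\in\mathbf{R}$,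 $x\in X$. The flow $\phi$ is an almost 1:1-extension of $\psi$ if there is such a semiconjugacy $h$ and some $x\in X$ with $h^{-1}(h(x))=\{x\}$. **Almost periodic.** The space $\Sigma$ carrying the almost periodic flow $\psi$ is a compact metric space. An orbit of a flow on a compact metric space is almost periodic if and only if it is uniformly Lyapunov stable (equicontinuous). An almost periodic flow is one whose orbits are almost periodic in this sense; for the minimal flow $\psi$ on $\Sigma$ this means that the family of time-$t$ maps $\{\psi(t,\cdot):t\in\mathbf{R}\}$ is equicontinuous. *)

theory Defs
  imports "HOL-Analysis.Analysis"
begin

definition flow :: "(real \<Rightarrow> 'a::topological_space \<Rightarrow> 'a) \<Rightarrow> bool" where
  "flow \<phi> \<longleftrightarrow>
     (\<forall>x. \<phi> 0 x = x) \<and> (\<forall>s t x. \<phi> (s + t) x = \<phi> s (\<phi> t x)) \<and>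
     continuous_on UNIV (\<lambda>(t, x). \<phi> t x)"

definition flow_invariant :: "(real \<Rightarrow> 'a \<Rightarrow> 'a) \<Rightarrow> 'a set \<Rightarrow> bool" where
  "flow_invariant \<phi> N \<longleftrightarrow> (\<forall>t. \<phi> t ` N \<subseteq> N)"

definition minimal_set :: "(real \<Rightarrow> 'a::topological_space \<Rightarrow> 'a) \<Rightarrow> 'a set \<Rightarrow> bool" where
  "minimal_set \<phi> M \<longleftrightarrow>
     M \<noteq> {} \<and> closed M \<and> flow_invariant \<phi> M \<and>
     (\<forall>N. N \<noteq> {} \<and> N \<subseteq> M \<and> closed N \<and> flow_invariant \<phi> N \<longrightarrow> N = M)"

definition minimal_flow :: "(real \<Rightarrow> 'a::topological_space \<Rightarrow> 'a) \<Rightarrow> bool" where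
  "minimal_flow \<phi> \<longleftrightarrow> flow \<phi> \<and> minimal_set \<phi> UNIV"

quotient_type circle = real / "\<lambda>x y. x - y \<in> \<int>"
  morphisms rep_circle to_circle
proof (rule equivpI)
  show "reflp (\<lambda>x y::real. x - y \<in> \<int>)"
    by (simp add: reflp_def)
  show "symp (\<lambda>x y::real. x - y \<in> \<int>)"
  proof (rule sympI)
    fix x y :: real
    assume "x - y \<in> \<int>"
    then have "- (x - y) \<in> \<int>" by (rule Ints_minus)
    then show "y - x \<in> \<int>" by simp
  qed
  show "transp (\<lambda>x y::real. x - y \<in> \<int>)"
  proof (rule transpI)
    fix x y z :: real
    assume "x - y \<in> \<int>" "y - z \<in> \<int>"
    then have "(x - y) + (y - z) \<in> \<int>" by (rule Ints_add)
    then show "x - z \<in> \<int>" by simp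
  qed
qed

instantiation circle :: topological_space
begin

definition open_circle :: "circle set \<Rightarrow> bool" where
  "open_circle U \<longleftrightarrow> open (to_circle -` U)"

instance
proof
  show "open (UNIV :: circle set)"
    by (simp add: open_circle_def)
  show "open (S \<inter> T)" if "open S" "open T" for S T :: "circle set"
    using that by (simp add: open_circle_def open_Int)
  show "open (\<Union>K)" if "\<forall>S\<in>K. open S" for K :: "circle set set"
    using that by (simp add: open_circle_def vimage_Union open_UN)
qed

end

definition orbit_exponent_group ::
    "(real \<Rightarrow> 'a::topological_space \<Rightarrow> 'a) \<Rightarrow> 'a \<Rightarrow> real set" where
  "orbit_exponent_group \<phi> x =
     {\<alpha>. \<forall>t :: nat \<Rightarrow> real.
        convergent (\<lambda>i. \<phi> (t i) x) \<longrightarrow> convergent (\<lambda>i. to_circle (\<alpha> * t i))}"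

text \<open>
  All orbits of a minimal set of a flow on a metric space have the same exponent group;
  this is \<open>orbit_exponent_group_eq\<close> below. The intersection is a way to name this common
  group that makes sense over an arbitrary phase space, where a topology not determined by its
  convergent sequences could give different orbits different groups.
\<close>

definition exponent_group ::
    "(real \<Rightarrow> 'a::topological_space \<Rightarrow> 'a) \<Rightarrow> 'a set \<Rightarrow> real set" where
  "exponent_group \<phi> M = (\<Inter>x\<in>M. orbit_exponent_group \<phi> x)"

lemma to_circle_eq_iff: "to_circle x = to_circle y \<longleftrightarrow> x - y \<in> \<int>"
  by (simp add: circle.abs_eq_iff)

lemma to_circle_surj: obtains x where "c = to_circle x"
  by (metis Quotient3_abs_rep Quotient3_circle)

lemma tendsto_to_circle_iff:
  "((\<lambda>i. to_circle (s i)) \<longlonglongrightarrow> to_circle a) \<longleftrightarrow>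
     (\<forall>e>0. \<forall>\<^sub>F i in sequentially. \<exists>m\<in>\<int>. \<bar>s i - a - m\<bar> < e)"
proof
  assume lim: "(\<lambda>i. to_circle (s i)) \<longlonglongrightarrow> to_circle a"
  show "\<forall>e>0. \<forall>\<^sub>F i in sequentially. \<exists>m\<in>\<int>. \<bar>s i - a - m\<bar> < e"
  proof (intro allI impI)
    fix e :: real assume "e > 0"
    define U where "U = to_circle ` ball a e"
    have "to_circle -` U = (\<Union>m\<in>\<int>. ball (a + m) e)"
    proof (intro set_eqI iffI)
      fix x assume "x \<in> to_circle -` U"
      then obtain y where y: "y \<in> ball a e" "x - y \<in> \<int>"
        by (auto simp: U_def to_circle_eq_iff)
      then have "x \<in> ball (a + (x - y)) e"
        by (simp add: dist_real_def)
      then show "x \<in> (\<Union>m\<in>\<int>. ball (a + m) e)" using y by blast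
    next
      fix x assume "x \<in> (\<Union>m\<in>\<int>. ball (a + m) e)"
      then obtain m where m: "m \<in> \<int>" "x \<in> ball (a + m) e" by blast
      then have "x - m \<in> ball a e" by (simp add: dist_real_def algebra_simps)
      moreover have "to_circle x = to_circle (x - m)"
        using m by (simp add: to_circle_eq_iff)
      ultimately show "x \<in> to_circle -` U" by (auto simp: U_def)
    qed
    then have "open U" by (simp add: open_circle_def open_UN)
    moreover have "to_circle a \<in> U" using \<open>e > 0\<close> by (simp add: U_def)
    ultimately have "\<forall>\<^sub>F i in sequentially. to_circle (s i) \<in> U"
      using lim topological_tendstoD by blast
    then show "\<forall>\<^sub>F i in sequentially. \<exists>m\<in>\<int>. \<bar>s i - a - m\<bar> < e"
    proof eventually_elim
      case (elim i)
      then obtain y where y: "y \<in> ball a e" "s i - y \<in> \<int>"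
        by (auto simp: U_def to_circle_eq_iff)
      then have "\<bar>s i - a - (s i - y)\<bar> < e"
        by (simp add: dist_real_def)
      then show ?case using y by blast
    qed
  qed
next
  assume *: "\<forall>e>0. \<forall>\<^sub>F i in sequentially. \<exists>m\<in>\<int>. \<bar>s i - a - m\<bar> < e"
  show "(\<lambda>i. to_circle (s i)) \<longlonglongrightarrow> to_circle a"
  proof (rule topological_tendstoI)
    fix U assume "open U" "to_circle a \<in> U"
    then obtain e where e: "e > 0" "ball a e \<subseteq> to_circle -` U"
      by (metis open_circle_def open_contains_ball vimageI)
    have "\<forall>\<^sub>F i in sequentially. \<exists>m\<in>\<int>. \<bar>s i - a - m\<bar> < e" using * e by blast
    then show "\<forall>\<^sub>F i in sequentially. to_circle (s i) \<in> U"
    proof eventually_elim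
      case (elim i)
      then obtain m where m: "m \<in> \<int>" "\<bar>s i - a - m\<bar> < e" by blast
      then have "s i - m \<in> ball a e" by (simp add: dist_real_def abs_if split: if_splits)
      then have "to_circle (s i - m) \<in> U" using e by blast
      moreover have "to_circle (s i) = to_circle (s i - m)"
        using m by (simp add: to_circle_eq_iff)
      ultimately show ?case by simp
    qed
  qed
qed

lemma convergent_to_circle_diff:
  assumes "convergent (\<lambda>i. to_circle (s i))" "convergent (\<lambda>i. to_circle (t i))"
  shows "convergent (\<lambda>i. to_circle (s i - t i))"
proof -
  obtain c d where cd: "(\<lambda>i. to_circle (s i)) \<longlonglongrightarrow> c" "(\<lambda>i. to_circle (t i)) \<longlonglongrightarrow> d"
    using assms by (auto simp: convergent_def)
  obtain a b where "c = to_circle a" "d = to_circle b"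
    using to_circle_surj[of c] to_circle_surj[of d] by metis
  with cd have ab: "(\<lambda>i. to_circle (s i)) \<longlonglongrightarrow> to_circle a"
      "(\<lambda>i. to_circle (t i)) \<longlonglongrightarrow> to_circle b"
    by simp_all
  have "(\<lambda>i. to_circle (s i - t i)) \<longlonglongrightarrow> to_circle (a - b)"
    unfolding tendsto_to_circle_iff
  proof (intro allI impI)
    fix e :: real assume "e > 0"
    then have "e / 2 > 0" by simp
    then have "\<forall>\<^sub>F i in sequentially. \<exists>m\<in>\<int>. \<bar>s i - a - m\<bar> < e / 2"
      "\<forall>\<^sub>F i in sequentially. \<exists>m\<in>\<int>. \<bar>t i - b - m\<bar> < e / 2"
      using ab unfolding tendsto_to_circle_iff by blast+
    then show "\<forall>\<^sub>F i in sequentially. \<exists>m\<in>\<int>. \<bar>s i - t i - (a - b) - m\<bar> < e"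
    proof eventually_elim
      case (elim i)
      then obtain m n where mn: "m \<in> \<int>" "n \<in> \<int>"
        "\<bar>s i - a - m\<bar> < e / 2" "\<bar>t i - b - n\<bar> < e / 2" by blast
      then have "\<bar>s i - t i - (a - b) - (m - n)\<bar> < e" by linarith
      then show ?case using mn Ints_diff by blast
    qed
  qed
  then show ?thesis by (auto simp: convergent_def)
qed

lemma flow_continuous:
  assumes "flow \<phi>"
  shows "continuous_on UNIV (\<phi> t)"
proof -
  have "continuous_on UNIV (\<lambda>x. (t, x))"
    by (intro continuous_intros)
  moreover have "continuous_on UNIV (\<lambda>(t, x). \<phi> t x)"
    using assms by (simp add: flow_def)
  ultimately have "continuous_on UNIV (\<lambda>x. (\<lambda>(t, x). \<phi> t x) (t, x))"
    using continuous_on_compose2 by blast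
  then show ?thesis by simp
qed

lemma minimal_set_orbit_dense:
  assumes "flow \<phi>" "minimal_set \<phi> M" "x \<in> M"
  shows "closure (range (\<lambda>t. \<phi> t x)) = M"
proof -
  let ?O = "range (\<lambda>t. \<phi> t x)"
  have sub: "?O \<subseteq> M"
    using assms by (auto simp: minimal_set_def flow_invariant_def)
  have "closure ?O \<subseteq> M"
    using assms(2) sub by (simp add: minimal_set_def closure_minimal)
  moreover have "flow_invariant \<phi> (closure ?O)"
    unfolding flow_invariant_def
  proof
    fix t
    show "\<phi> t ` closure ?O \<subseteq> closure ?O"
    proof (rule image_closure_subset)
      show "continuous_on (closure ?O) (\<phi> t)"
        by (rule continuous_on_subset[OF flow_continuous[OF assms(1)] subset_UNIV])
      have "\<phi> t (\<phi> u x) = \<phi> (t + u) x" for u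
        using assms(1) by (simp add: flow_def)
      then show "\<phi> t ` ?O \<subseteq> closure ?O"
        using closure_subset[of ?O] by auto
    qed simp
  qed
  moreover have "closure ?O \<noteq> {}" by simp
  ultimately show ?thesis using assms(2) by (auto simp: minimal_set_def)
qed

lemma orbit_exponent_group_subset:
  fixes \<phi> :: "real \<Rightarrow> 'a::metric_space \<Rightarrow> 'a"
  assumes fl: "flow \<phi>" and M: "minimal_set \<phi> M" and x: "x \<in> M" and y: "y \<in> M"
  shows "orbit_exponent_group \<phi> x \<subseteq> orbit_exponent_group \<phi> y"
proof
  fix \<alpha> assume \<alpha>: "\<alpha> \<in> orbit_exponent_group \<phi> x"
  show "\<alpha> \<in> orbit_exponent_group \<phi> y"
    unfolding orbit_exponent_group_def mem_Collect_eq
  proof (intro allI impI)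
    fix s :: "nat \<Rightarrow> real"
    assume "convergent (\<lambda>i. \<phi> (s i) y)"
    then obtain z where z: "(\<lambda>i. \<phi> (s i) y) \<longlonglongrightarrow> z" by (auto simp: convergent_def)
    have "\<exists>t. dist (\<phi> t x) y < inverse (real (Suc i)) \<and>
              dist (\<phi> (s i + t) x) (\<phi> (s i) y) < inverse (real (Suc i))" for i
    proof -
      have "isCont (\<phi> (s i)) y"
        using flow_continuous[OF fl, of "s i"] by (simp add: continuous_on_eq_continuous_at)
      then obtain d where d: "d > 0"
        "\<And>w. dist w y < d \<Longrightarrow> dist (\<phi> (s i) w) (\<phi> (s i) y) < inverse (real (Suc i))"
        unfolding continuous_at_eps_delta
        by (meson inverse_positive_iff_positive of_nat_0_less_iff zero_less_Suc)
      have "y \<in> closure (range (\<lambda>t. \<phi> t x))"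
        using minimal_set_orbit_dense[OF fl M x] y by simp
      moreover have "min d (inverse (real (Suc i))) > 0" using d by simp
      ultimately obtain t where "dist (\<phi> t x) y < min d (inverse (real (Suc i)))"
        unfolding closure_approachable by blast
      then have "dist (\<phi> t x) y < inverse (real (Suc i))"
        "dist (\<phi> (s i) (\<phi> t x)) (\<phi> (s i) y) < inverse (real (Suc i))"
        using d(2) by simp_all
      moreover have "\<phi> (s i + t) x = \<phi> (s i) (\<phi> t x)"
        using fl by (simp add: flow_def)
      ultimately show ?thesis by auto
    qed
    then obtain t where t: "\<And>i. dist (\<phi> (t i) x) y < inverse (real (Suc i))"
      "\<And>i. dist (\<phi> (s i + t i) x) (\<phi> (s i) y) < inverse (real (Suc i))" by metis
    have "(\<lambda>i. dist (\<phi> (t i) x) y) \<longlonglongrightarrow> 0"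
      by (rule tendsto_sandwich[OF _ _ tendsto_const LIMSEQ_inverse_real_of_nat])
         (use t(1) in \<open>simp_all add: less_imp_le\<close>)
    then have "convergent (\<lambda>i. \<phi> (t i) x)"
      unfolding convergent_def using tendsto_dist_iff by blast
    then have 1: "convergent (\<lambda>i. to_circle (\<alpha> * t i))"
      using \<alpha> by (auto simp: orbit_exponent_group_def)
    have "(\<lambda>i. dist (\<phi> (s i + t i) x) (\<phi> (s i) y)) \<longlonglongrightarrow> 0"
      by (rule tendsto_sandwich[OF _ _ tendsto_const LIMSEQ_inverse_real_of_nat])
         (use t(2) in \<open>simp_all add: less_imp_le\<close>)
    from tendsto_add[OF this z[unfolded tendsto_dist_iff[of _ z]]]
    have sum0: "(\<lambda>i. dist (\<phi> (s i + t i) x) (\<phi> (s i) y) + dist (\<phi> (s i) y) z) \<longlonglongrightarrow> 0"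
      by simp
    have "(\<lambda>i. dist (\<phi> (s i + t i) x) z) \<longlonglongrightarrow> 0"
      by (rule tendsto_sandwich[OF _ _ tendsto_const sum0])
         (simp_all add: dist_triangle)
    then have "convergent (\<lambda>i. \<phi> (s i + t i) x)"
      unfolding convergent_def using tendsto_dist_iff by blast
    then have 2: "convergent (\<lambda>i. to_circle (\<alpha> * (s i + t i)))"
      using \<alpha> by (auto simp: orbit_exponent_group_def)
    show "convergent (\<lambda>i. to_circle (\<alpha> * s i))"
      using convergent_to_circle_diff[OF 2 1] by (simp add: algebra_simps)
  qed
qed

lemma orbit_exponent_group_eq:
  fixes \<phi> :: "real \<Rightarrow> 'a::metric_space \<Rightarrow> 'a"
  assumes "flow \<phi>" "minimal_set \<phi> M" "x \<in> M"
  shows "orbit_exponent_group \<phi> x = exponent_group \<phi> M"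
  using orbit_exponent_group_subset[OF assms(1,2)] assms(3)
  unfolding exponent_group_def by blast

text \<open>
  Equicontinuity of the family of time-\<open>t\<close> maps, required at every point; on a compact space this
  is the same as uniform equicontinuity, i.e. uniform Lyapunov stability.
\<close>

definition almost_periodic_flow :: "(real \<Rightarrow> 'a::metric_space \<Rightarrow> 'a) \<Rightarrow> bool" where
  "almost_periodic_flow \<psi> \<longleftrightarrow> flow \<psi> \<and>
     (\<forall>x. \<forall>e>0. \<exists>d>0. \<forall>y. dist y x < d \<longrightarrow> (\<forall>t. dist (\<psi> t y) (\<psi> t x) < e))"

definition semiconjugacy ::
    "(real \<Rightarrow> 'a::topological_space \<Rightarrow> 'a) \<Rightarrow> (real \<Rightarrow> 'b::topological_space \<Rightarrow> 'b) \<Rightarrow>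
      ('a \<Rightarrow> 'b) \<Rightarrow> bool" where
  "semiconjugacy \<phi> \<psi> h \<longleftrightarrow>
     continuous_on UNIV h \<and> surj h \<and> (\<forall>t x. h (\<phi> t x) = \<psi> t (h x))"

definition almost_one_to_one_extension ::
    "(real \<Rightarrow> 'a::topological_space \<Rightarrow> 'a) \<Rightarrow> (real \<Rightarrow> 'b::topological_space \<Rightarrow> 'b) \<Rightarrow> bool" where
  "almost_one_to_one_extension \<phi> \<psi> \<longleftrightarrow>
     (\<exists>h. semiconjugacy \<phi> \<psi> h \<and> (\<exists>x. h -` {h x} = {x}))"

end

theory Submission imports Defs
begin

text \<open>
  Let \<open>h\<close> be the semiconjugacy and \<open>x\<close> a point whose fibre is \<open>{x}\<close>. By compactness, times \<open>s\<close>
  that bring \<open>h x\<close> back close to itself also bring \<open>x\<close> back close to itself, so an exponent \<open>\<alpha>\<close> of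
  the orbit of \<open>x\<close> makes \<open>\<alpha> s\<close> close to an integer. If \<open>\<psi> (t i) (h x)\<close> converges, equicontinuity
  makes \<open>t i - t j\<close> such return times for large \<open>i\<close> and \<open>j\<close>, so \<open>\<alpha> t i\<close> is a Cauchy sequence
  modulo \<open>1\<close>. Hence \<open>\<alpha>\<close> is an exponent of the orbit of \<open>h x\<close>.
\<close>

text \<open>Completeness of the circle. Compactness of [0,1] gives a cluster point \<open>c\<close>
  of the fractional parts, and the Cauchy condition modulo 1 draws the whole sequence to the class
  of \<open>c\<close>.\<close>

lemma convergent_to_circle_Cauchy:
  assumes "\<And>e. e > 0 \<Longrightarrow> \<exists>N. \<forall>i\<ge>N. \<forall>j\<ge>N. \<exists>m\<in>\<int>. \<bar>s i - s j - m\<bar> < e"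
  shows "convergent (\<lambda>i. to_circle (s i))"
proof -
  have "\<forall>i. frac (s i) \<in> {0..1}"
    by (simp add: frac_ge_0 less_imp_le[OF frac_lt_1])
  then obtain c r where r: "strict_mono (r :: nat \<Rightarrow> nat)"
    and lim: "((\<lambda>i. frac (s i)) \<circ> r) \<longlonglongrightarrow> c"
    using seq_compactE[OF compact_imp_seq_compact[OF compact_Icc], of "\<lambda>i. frac (s i)" 0 1] by blast
  have "(\<lambda>i. to_circle (s i)) \<longlonglongrightarrow> to_circle c"
    unfolding tendsto_to_circle_iff
  proof (intro allI impI)
    fix e :: real assume "e > 0"
    then have e2: "e / 2 > 0" by simp
    obtain N where N: "\<And>i j. i \<ge> N \<Longrightarrow> j \<ge> N \<Longrightarrow> \<exists>m\<in>\<int>. \<bar>s i - s j - m\<bar> < e / 2"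
      using assms[OF e2] by blast
    obtain K where K: "\<And>k. k \<ge> K \<Longrightarrow> \<bar>frac (s (r k)) - c\<bar> < e / 2"
      using LIMSEQ_D[OF lim e2] by auto
    \<comment> \<open>A single index that is both past \<open>N\<close> and a term of the
      subsequence within \<open>e / 2\<close> of \<open>c\<close>.\<close>
    define j where "j = r (max N K)"
    have "j \<ge> N"
      using seq_suble[OF r, of "max N K"] by (simp add: j_def)
    have jc: "\<bar>frac (s j) - c\<bar> < e / 2"
      unfolding j_def by (rule K) simp
    have "\<exists>m\<in>\<int>. \<bar>s i - c - m\<bar> < e" if "i \<ge> N" for i
    proof -
      obtain m where m: "m \<in> \<int>" "\<bar>s i - s j - m\<bar> < e / 2"
        using N[OF \<open>i \<ge> N\<close> \<open>j \<ge> N\<close>] by blast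
      \<comment> \<open>The floor turns \<open>frac (s j)\<close> back into \<open>s j\<close>, so
        it joins the integer correction.\<close>
      have "\<bar>s i - c - (m + of_int \<lfloor>s j\<rfloor>)\<bar> < e"
        using m(2) jc unfolding frac_def by linarith
      then show ?thesis using m(1) by (meson Ints_add Ints_of_int)
    qed
    then show "\<forall>\<^sub>F i in sequentially. \<exists>m\<in>\<int>. \<bar>s i - c - m\<bar> < e"
      unfolding eventually_sequentially by blast
  qed
  then show ?thesis by (auto simp: convergent_def)
qed

lemma tendsto_singleton_fibre:
  fixes h :: "'a::topological_space \<Rightarrow> 'b::t2_space"
  assumes comp: "compact (UNIV :: 'a set)" and cont: "continuous_on UNIV h"
    and fib: "h -` {h x} = {x}" and lim: "((\<lambda>i. h (f i)) \<longlongrightarrow> h x) F"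
  shows "(f \<longlongrightarrow> x) F"
proof (rule topological_tendstoI)
  fix U assume U: "open U" "x \<in> U"
  have "compact (- U)"
    using compact_Int_closed[OF comp, of "- U"] U(1) by (simp add: closed_def)
  then have "closed (h ` (- U))"
    using compact_continuous_image[OF continuous_on_subset[OF cont subset_UNIV]]
      compact_imp_closed by blast
  then have "open (- h ` (- U))" by (rule open_Compl)
  moreover have "h x \<in> - h ` (- U)"
  proof
    assume "h x \<in> h ` (- U)"
    then obtain w where "w \<notin> U" "h w = h x" by auto
    then have "w \<in> h -` {h x}" by simp
    with fib U(2) \<open>w \<notin> U\<close> show False by auto
  qed
  ultimately have "\<forall>\<^sub>F i in F. h (f i) \<in> - h ` (- U)"
    using lim topological_tendstoD by blast
  then show "\<forall>\<^sub>F i in F. f i \<in> U"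
    by (rule eventually_mono) blast
qed

text \<open>Closed invariant sets pull back along \<open>h\<close>. Minimality of \<psi> is what
  makes all its orbits share one exponent group.\<close>

lemma minimal_flow_factor:
  assumes \<phi>: "minimal_flow \<phi>" and \<psi>: "flow \<psi>" and h: "semiconjugacy \<phi> \<psi> h"
  shows "minimal_flow \<psi>"
proof -
  have "N = UNIV" if N: "N \<noteq> {}" "closed N" "flow_invariant \<psi> N" for N
  proof -
    have "closed (h -` N)"
      using h N(2) by (simp add: semiconjugacy_def closed_vimage)
    moreover have "flow_invariant \<phi> (h -` N)"
      using h N(3) by (simp add: semiconjugacy_def flow_invariant_def image_subset_iff)
    moreover have "h -` N \<noteq> {}"
      using h N(1) by (metis semiconjugacy_def surj_vimage_empty)
    ultimately have "h -` N = UNIV"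
      using \<phi> by (simp add: minimal_flow_def minimal_set_def)
    then show ?thesis
      using h by (metis semiconjugacy_def surj_image_vimage_eq)
  qed
  then show ?thesis
    using \<psi> by (simp add: minimal_flow_def minimal_set_def flow_invariant_def)
qed

text \<open>Continuity of \<open>h\<close> carries convergent orbit sequences of \<phi> to
  convergent ones of \<psi>, so an exponent for \<psi> passes the test for \<phi>. This works at
  every \<open>x\<close>, whatever its fibre.\<close>

lemma orbit_exponent_group_factor:
  assumes h: "semiconjugacy \<phi> \<psi> h"
  shows "orbit_exponent_group \<psi> (h x) \<subseteq> orbit_exponent_group \<phi> x"
proof -
  have cont: "continuous_on UNIV h" and eq: "\<And>t y. \<psi> t (h y) = h (\<phi> t y)"
    using h by (simp_all add: semiconjugacy_def)
  have "convergent (\<lambda>i. \<psi> (t i) (h x))" if conv: "convergent (\<lambda>i. \<phi> (t i) x)" for t :: "nat \<Rightarrow> real"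
  proof -
    obtain z where z: "(\<lambda>i. \<phi> (t i) x) \<longlonglongrightarrow> z"
      using conv unfolding convergent_def by blast
    have "(\<lambda>i. h (\<phi> (t i) x)) \<longlonglongrightarrow> h z"
      by (rule continuous_on_tendsto_compose[OF cont z]) simp_all
    then show ?thesis
      unfolding eq convergent_def by blast
  qed
  then show ?thesis by (auto simp: orbit_exponent_group_def)
qed

lemma exponent_return_times:
  fixes \<psi> :: "real \<Rightarrow> 's::metric_space \<Rightarrow> 's"
  assumes comp: "compact (UNIV :: 'm::topological_space set)"
    and \<phi>: "flow (\<phi> :: real \<Rightarrow> 'm \<Rightarrow> 'm)" and h: "semiconjugacy \<phi> \<psi> h"
    and fib: "h -` {h x} = {x}"
    and \<alpha>: "\<alpha> \<in> orbit_exponent_group \<phi> x" and e: "e > 0"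
  shows "\<exists>d>0. \<forall>s. dist (\<psi> s (h x)) (h x) < d \<longrightarrow> (\<exists>m\<in>\<int>. \<bar>\<alpha> * s - m\<bar> < e)"
proof (rule ccontr)
  assume "\<not> ?thesis"
  then have *: "\<exists>s. dist (\<psi> s (h x)) (h x) < d \<and> (\<forall>m\<in>\<int>. \<not> \<bar>\<alpha> * s - m\<bar> < e)" if "d > 0" for d
    using that by blast
  have "\<exists>s. dist (\<psi> s (h x)) (h x) < inverse (real (Suc i)) \<and>
      (\<forall>m\<in>\<int>. \<not> \<bar>\<alpha> * s - m\<bar> < e)" for i
    by (rule *) simp
  then obtain s where s: "\<And>i. dist (\<psi> (s i) (h x)) (h x) < inverse (real (Suc i))"
      "\<And>i. \<forall>m\<in>\<int>. \<not> \<bar>\<alpha> * s i - m\<bar> < e"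
    using choice[of "\<lambda>i s. dist (\<psi> s (h x)) (h x) < inverse (real (Suc i)) \<and>
      (\<forall>m\<in>\<int>. \<not> \<bar>\<alpha> * s - m\<bar> < e)"] by blast
  have cont: "continuous_on UNIV h" and eq: "\<And>t y. h (\<phi> t y) = \<psi> t (h y)"
    using h by (simp_all add: semiconjugacy_def)
  \<comment> \<open>Interleaving with the time \<open>0\<close> forces the limit of \<open>\<alpha> * s i\<close> modulo \<open>1\<close> to be \<open>0\<close>.\<close>
  define t where "t i = (if even i then 0 else s i)" for i
  \<comment> \<open>Pushed down from \<phi> through \<open>h\<close>.\<close>
  have hx: "\<psi> 0 (h x) = h x"
    using \<phi> by (simp add: flow_def flip: eq)
  have "dist (\<psi> (t i) (h x)) (h x) \<le> inverse (real (Suc i))" for i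
    using less_imp_le[OF s(1)[of i]] hx by (cases "even i") (simp_all add: t_def)
  then have "(\<lambda>i. dist (\<psi> (t i) (h x)) (h x)) \<longlonglongrightarrow> 0"
    by (intro tendsto_sandwich[OF _ _ tendsto_const LIMSEQ_inverse_real_of_nat]) simp_all
  then have "(\<lambda>i. h (\<phi> (t i) x)) \<longlonglongrightarrow> h x"
    unfolding eq by (rule tendsto_dist_iff[THEN iffD2])
  then have "(\<lambda>i. \<phi> (t i) x) \<longlonglongrightarrow> x"
    by (rule tendsto_singleton_fibre[OF comp cont fib])
  then have "convergent (\<lambda>i. to_circle (\<alpha> * t i))"
    using \<alpha> unfolding orbit_exponent_group_def convergent_def by blast
  then obtain C where C: "(\<lambda>i. to_circle (\<alpha> * t i)) \<longlonglongrightarrow> C"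
    unfolding convergent_def by blast
  obtain c where c: "C = to_circle c" by (rule to_circle_surj)
  have "\<forall>\<^sub>F i in sequentially. \<exists>m\<in>\<int>. \<bar>\<alpha> * t i - c - m\<bar> < e / 2"
    using C half_gt_zero[OF e] by (simp only: c tendsto_to_circle_iff)
  then obtain N where N: "\<And>i. i \<ge> N \<Longrightarrow> \<exists>m\<in>\<int>. \<bar>\<alpha> * t i - c - m\<bar> < e / 2"
    unfolding eventually_sequentially by blast
  \<comment> \<open>Compare two neighbouring terms past \<open>N\<close>: the even one puts
    \<open>c\<close> near an integer, the odd one puts \<open>\<alpha> * s i\<close> near
    \<open>c\<close> modulo 1.\<close>
  have t: "t (2 * N) = 0" "t (2 * N + 1) = s (2 * N + 1)"
    by (simp_all add: t_def)
  obtain m where m: "m \<in> \<int>" "\<bar>\<alpha> * 0 - c - m\<bar> < e / 2"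
    using N[of "2 * N"] unfolding t by auto
  obtain n where n: "n \<in> \<int>" "\<bar>\<alpha> * s (2 * N + 1) - c - n\<bar> < e / 2"
    using N[of "2 * N + 1"] unfolding t by auto
  have "\<bar>\<alpha> * s (2 * N + 1) - (n - m)\<bar> < e"
    using m(2) n(2) unfolding mult_zero_right by linarith
  then show False using s(2) Ints_diff[OF n(1) m(1)] by blast
qed

text \<open>Equicontinuity is used at the limit \<open>z\<close>: for large i and j, the time
  \<open>- t j\<close> map sends both \<open>\<psi> (t i) y\<close> and
  \<open>\<psi> (t j) y\<close> close to \<open>\<psi> (- t j) z\<close>, with a bound independent
  of \<open>t j\<close>.\<close>

lemma equicontinuous_orbit_return_times:
  assumes \<psi>: "almost_periodic_flow \<psi>" and lim: "(\<lambda>i. \<psi> (t i) y) \<longlonglongrightarrow> z" and d: "d > 0"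
  shows "\<exists>N. \<forall>i\<ge>N. \<forall>j\<ge>N. dist (\<psi> (t i - t j) y) y < d"
proof -
  obtain \<delta> where \<delta>: "\<delta> > 0" "\<And>w u. dist w z < \<delta> \<Longrightarrow> dist (\<psi> u w) (\<psi> u z) < d / 2"
    using \<psi> d unfolding almost_periodic_flow_def by (meson half_gt_zero)
  obtain N where N: "\<And>i. i \<ge> N \<Longrightarrow> dist (\<psi> (t i) y) z < \<delta>"
    using lim \<delta>(1) unfolding lim_sequentially by blast
  have fl: "\<psi> (u + v) w = \<psi> u (\<psi> v w)" "\<psi> 0 w = w" for u v w
    using \<psi> by (auto simp: almost_periodic_flow_def flow_def)
  have "dist (\<psi> (t i - t j) y) y < d" if "i \<ge> N" "j \<ge> N" for i j
  proof -
    have "\<psi> (- t j) (\<psi> (t i) y) = \<psi> (t i - t j) y" "\<psi> (- t j) (\<psi> (t j) y) = y"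
      by (simp_all add: fl(2) flip: fl(1))
    then have "dist (\<psi> (t i - t j) y) (\<psi> (- t j) z) < d / 2" "dist y (\<psi> (- t j) z) < d / 2"
      using \<delta>(2)[OF N[OF that(1)], of "- t j"] \<delta>(2)[OF N[OF that(2)], of "- t j"] by simp_all
    then show ?thesis by (rule dist_triangle_half_l)
  qed
  then show ?thesis by blast
qed

lemma orbit_exponent_group_singleton_fibre:
  assumes "compact (UNIV :: 'm::topological_space set)"
    and "flow (\<phi> :: real \<Rightarrow> 'm \<Rightarrow> 'm)" "almost_periodic_flow \<psi>"
    and "semiconjugacy \<phi> \<psi> h" "h -` {h x} = {x}"
  shows "orbit_exponent_group \<phi> x \<subseteq> orbit_exponent_group \<psi> (h x)"
proof
  fix \<alpha> assume \<alpha>: "\<alpha> \<in> orbit_exponent_group \<phi> x"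
  show "\<alpha> \<in> orbit_exponent_group \<psi> (h x)"
    unfolding orbit_exponent_group_def mem_Collect_eq
  proof (intro allI impI)
    fix t :: "nat \<Rightarrow> real"
    assume "convergent (\<lambda>i. \<psi> (t i) (h x))"
    then obtain z where z: "(\<lambda>i. \<psi> (t i) (h x)) \<longlonglongrightarrow> z" by (auto simp: convergent_def)
    show "convergent (\<lambda>i. to_circle (\<alpha> * t i))"
    proof (rule convergent_to_circle_Cauchy)
      fix e :: real assume "e > 0"
      then obtain d where d: "d > 0"
        "\<And>s. dist (\<psi> s (h x)) (h x) < d \<Longrightarrow> \<exists>m\<in>\<int>. \<bar>\<alpha> * s - m\<bar> < e"
        using exponent_return_times[OF assms(1,2,4,5) \<alpha>] by metis
      show "\<exists>N. \<forall>i\<ge>N. \<forall>j\<ge>N. \<exists>m\<in>\<int>. \<bar>\<alpha> * t i - \<alpha> * t j - m\<bar> < e"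
        using equicontinuous_orbit_return_times[OF assms(3) z d(1)] d(2)
        by (metis right_diff_distrib)
    qed
  qed
qed

theorem theorem8:
  fixes \<phi> :: "real \<Rightarrow> 'm::topological_space \<Rightarrow> 'm"
    and \<psi> :: "real \<Rightarrow> 's::metric_space \<Rightarrow> 's"
  assumes "compact (UNIV :: 'm set)"
    and "compact (UNIV :: 's set)"
    and "minimal_flow \<phi>"
    and "almost_periodic_flow \<psi>"
    and "almost_one_to_one_extension \<phi> \<psi>"
  shows "exponent_group \<phi> UNIV = exponent_group \<psi> UNIV"
proof -
  obtain h x where h: "semiconjugacy \<phi> \<psi> h" and fib: "h -` {h x} = {x}"
    using assms(5) by (auto simp: almost_one_to_one_extension_def)
  have fl: "flow \<phi>" "flow \<psi>"
    using assms(3,4) by (auto simp: minimal_flow_def almost_periodic_flow_def)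
  have "minimal_set \<psi> UNIV"
    using minimal_flow_factor[OF assms(3) fl(2) h] by (simp add: minimal_flow_def)
  then have eq: "orbit_exponent_group \<psi> y = exponent_group \<psi> UNIV" for y
    by (rule orbit_exponent_group_eq[OF fl(2) _ UNIV_I])
  show ?thesis
  proof
    \<comment> \<open>Here the one orbit with singleton fibre suffices, as the group of \<phi> is an
      intersection over all orbits.\<close>
    have "exponent_group \<phi> UNIV \<subseteq> orbit_exponent_group \<phi> x"
      by (auto simp: exponent_group_def)
    also have "\<dots> \<subseteq> exponent_group \<psi> UNIV"
      using orbit_exponent_group_singleton_fibre[OF assms(1) fl(1) assms(4) h fib] eq by simp
    finally show "exponent_group \<phi> UNIV \<subseteq> exponent_group \<psi> UNIV" .
    \<comment> \<open>Here every orbit of \<phi> must be tested; each is compared with the orbit of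
      its image, whose group is the common one.\<close>
    show "exponent_group \<psi> UNIV \<subseteq> exponent_group \<phi> UNIV"
      using orbit_exponent_group_factor[OF h] eq unfolding exponent_group_def[of \<phi>] by blast
  qed
qed

end
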